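(* For any positive integers $t$ and $d$, there exists a weighted unitary $t$-design $(X,w)$ in $\mathrm{U}(d)$ with \[ |X| \leq \dim\mathrm{Hom}_{\mathrm{U}(d)}(t,t). \]
   Context: $\mathrm{U}(d)$ is the group of $d\times d$ unitary matrices with normalized Haar measure $dU$. For finite $X\subseteq\mathrm{U}(d)$ and $w:X\to\mathbb{R}$ with $w>0$ and $\sum_{U\in X}w(U)=1$, $(X,w)$ is a weighted unitary $t$-design if $\sum_{U\in X}w(U)\,U^{\otimes t}\otimes(U^* )^{\otimes t}=\int_{\mathrm{U}(d)}U^{\otimes t}\otimes(U^* )^{\otimes t}\,dU$. $\mathrm{Hom}_{\mathrm{U}(d)}(t,t)$ is the complex vector space of functions on $\mathrm{U}(d)$ given by polynomials homogeneous of degree $t$ in the entries of $U$ and of degree $t$ in the entries of $U^*$. *)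

theory Defs
  imports "HOL-Probability.Probability"
    "HOL-Library.Function_Algebras"
begin

definition ctranspose :: "complex ^ 'n ^ 'm \<Rightarrow> complex ^ 'm ^ 'n" where
  "ctranspose A = (\<chi> i j. cnj (A $ j $ i))"

definition unitary_group :: "(complex ^ 'n ^ 'n) set" where
  "unitary_group = {U. U ** ctranspose U = mat 1 \<and> ctranspose U ** U = mat 1}"

text \<open>The topology on the unitary group is the one inherited from the space of all matrices.
  A normalized Haar measure is a left-invariant Borel probability measure; on this compact group
  there is exactly one.\<close>

definition normalized_haar :: "(complex ^ 'n ^ 'n) measure \<Rightarrow> bool" where
  "normalized_haar \<mu> \<longleftrightarrow>
     prob_space \<mu> \<and>
     sets \<mu> = sets (restrict_space borel unitary_group) \<and>
     (\<forall>V\<in>unitary_group. distr \<mu> \<mu> (\<lambda>U. V ** U) = \<mu>)"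

text \<open>Since the tensor exponent \<open>t\<close> is a number and not a type, tensor powers are represented as
  matrices given by their entries: rows and columns of a \<open>t\<close>-th tensor power are indexed by the
  lists of length \<open>t\<close> over the original index type, those of a Kronecker product by pairs.\<close>

definition tensor_power ::
  "nat \<Rightarrow> complex ^ 'n ^ 'm \<Rightarrow> 'm list \<Rightarrow> 'n list \<Rightarrow> complex" where
  "tensor_power t A = (\<lambda>I J. \<Prod>r<t. A $ (I ! r) $ (J ! r))"

definition kronecker ::
  "('i \<Rightarrow> 'j \<Rightarrow> complex) \<Rightarrow> ('k \<Rightarrow> 'l \<Rightarrow> complex) \<Rightarrow> 'i \<times> 'k \<Rightarrow> 'j \<times> 'l \<Rightarrow> complex" where
  "kronecker A B = (\<lambda>(i, k) (j, l). A i j * B k l)"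

definition design_tensor ::
  "nat \<Rightarrow> complex ^ 'n ^ 'n \<Rightarrow> 'n list \<times> 'n list \<Rightarrow> 'n list \<times> 'n list \<Rightarrow> complex" where
  "design_tensor t U = kronecker (tensor_power t U) (tensor_power t (ctranspose U))"

definition tensor_indices :: "nat \<Rightarrow> ('n list \<times> 'n list) set" where
  "tensor_indices t = {I. length I = t} \<times> {I. length I = t}"

text \<open>The identity between the averaged matrices is an identity of all their entries; the integral
  of a matrix-valued function is taken entrywise.\<close>

definition weighted_unitary_design ::
  "(complex ^ 'n ^ 'n) measure \<Rightarrow> nat \<Rightarrow> (complex ^ 'n ^ 'n) set \<Rightarrow>
   (complex ^ 'n ^ 'n \<Rightarrow> real) \<Rightarrow> bool" where
  "weighted_unitary_design \<mu> t X w \<longleftrightarrow>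
     finite X \<and> X \<subseteq> unitary_group \<and>
     (\<forall>U\<in>X. w U > 0) \<and> (\<Sum>U\<in>X. w U) = 1 \<and>
     (\<forall>a\<in>tensor_indices t. \<forall>b\<in>tensor_indices t.
        (\<Sum>U\<in>X. of_real (w U) * design_tensor t U a b) = (\<integral>U. design_tensor t U a b \<partial>\<mu>))"

definition degree_exponents :: "nat \<Rightarrow> ('n::finite \<Rightarrow> 'n \<Rightarrow> nat) set" where
  "degree_exponents t = {\<alpha>. (\<Sum>i\<in>UNIV. \<Sum>j\<in>UNIV. \<alpha> i j) = t}"

definition matrix_monomial :: "('n \<Rightarrow> 'n \<Rightarrow> nat) \<Rightarrow> complex ^ 'n ^ 'n \<Rightarrow> complex" where
  "matrix_monomial \<alpha> A = (\<Prod>i\<in>UNIV. \<Prod>j\<in>UNIV. (A $ i $ j) ^ \<alpha> i j)"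

text \<open>Functions on the unitary group are represented by functions on all matrices that vanish off
  the unitary group, so that polynomials agreeing on the group give the same element.\<close>

definition hom_space :: "nat \<Rightarrow> (complex ^ 'n ^ 'n \<Rightarrow> complex) set" where
  "hom_space t =
     {f. \<exists>c :: ('n \<Rightarrow> 'n \<Rightarrow> nat) \<Rightarrow> ('n \<Rightarrow> 'n \<Rightarrow> nat) \<Rightarrow> complex.
           f = (\<lambda>U. if U \<in> unitary_group
                    then \<Sum>\<alpha>\<in>degree_exponents t. \<Sum>\<beta>\<in>degree_exponents t.
                           c \<alpha> \<beta> * matrix_monomial \<alpha> U * matrix_monomial \<beta> (ctranspose U)
                    else 0)}"

definition fun_scale :: "complex \<Rightarrow> ('a \<Rightarrow> complex) \<Rightarrow> 'a \<Rightarrow> complex" where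
  "fun_scale c f = (\<lambda>x. c * f x)"

global_interpretation complex_fun: vector_space "fun_scale :: complex \<Rightarrow> ('a \<Rightarrow> complex) \<Rightarrow> _"
  by unfold_locales (auto simp: fun_scale_def fun_eq_iff algebra_simps)

lemma finite_degree_exponents: "finite (degree_exponents t :: ('n::finite \<Rightarrow> 'n \<Rightarrow> nat) set)"
proof (rule finite_subset)
  show "degree_exponents t \<subseteq> (UNIV \<rightarrow>\<^sub>E (UNIV \<rightarrow>\<^sub>E {..t}) :: ('n \<Rightarrow> 'n \<Rightarrow> nat) set)"
  proof
    fix \<alpha> :: "'n \<Rightarrow> 'n \<Rightarrow> nat" assume a: "\<alpha> \<in> degree_exponents t"
    have "\<alpha> i j \<le> t" for i j
    proof -
      have "\<alpha> i j \<le> (\<Sum>j\<in>UNIV. \<alpha> i j)" by (rule member_le_sum) auto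
      also have "\<dots> \<le> (\<Sum>i\<in>UNIV. \<Sum>j\<in>UNIV. \<alpha> i j)"
        by (rule member_le_sum[where f = "\<lambda>i. \<Sum>j\<in>UNIV. \<alpha> i j"]) auto
      finally show ?thesis using a by (simp add: degree_exponents_def)
    qed
    then show "\<alpha> \<in> UNIV \<rightarrow>\<^sub>E (UNIV \<rightarrow>\<^sub>E {..t})" by (auto simp: PiE_def)
  qed
qed (intro finite_PiE; simp)+

lemma hom_space_subspace: "complex_fun.subspace (hom_space t)"
proof (rule complex_fun.subspaceI)
  show "0 \<in> hom_space t"
    unfolding hom_space_def by (auto simp: fun_eq_iff intro!: exI[of _ "\<lambda>_ _. 0"])
next
  fix f g :: "complex ^ 'n ^ 'n \<Rightarrow> complex"
  assume "f \<in> hom_space t" "g \<in> hom_space t"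
  then obtain c c' where
    "f = (\<lambda>U. if U \<in> unitary_group then \<Sum>\<alpha>\<in>degree_exponents t. \<Sum>\<beta>\<in>degree_exponents t.
       c \<alpha> \<beta> * matrix_monomial \<alpha> U * matrix_monomial \<beta> (ctranspose U) else 0)"
    "g = (\<lambda>U. if U \<in> unitary_group then \<Sum>\<alpha>\<in>degree_exponents t. \<Sum>\<beta>\<in>degree_exponents t.
       c' \<alpha> \<beta> * matrix_monomial \<alpha> U * matrix_monomial \<beta> (ctranspose U) else 0)"
    unfolding hom_space_def by blast
  then show "f + g \<in> hom_space t"
    unfolding hom_space_def
    by (auto simp: fun_eq_iff sum.distrib algebra_simps intro!: exI[of _ "\<lambda>\<alpha> \<beta>. c \<alpha> \<beta> + c' \<alpha> \<beta>"])
next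
  fix a and f :: "complex ^ 'n ^ 'n \<Rightarrow> complex"
  assume "f \<in> hom_space t"
  then obtain c where
    "f = (\<lambda>U. if U \<in> unitary_group then \<Sum>\<alpha>\<in>degree_exponents t. \<Sum>\<beta>\<in>degree_exponents t.
       c \<alpha> \<beta> * matrix_monomial \<alpha> U * matrix_monomial \<beta> (ctranspose U) else 0)"
    unfolding hom_space_def by blast
  then show "fun_scale a f \<in> hom_space t"
    unfolding hom_space_def fun_scale_def
    by (auto simp: fun_eq_iff sum_distrib_left algebra_simps intro!: exI[of _ "\<lambda>\<alpha> \<beta>. a * c \<alpha> \<beta>"])
qed

end

theory Submission imports Defs begin

text \<open>
  This is Tchakaloff's theorem for the finite-dimensional space \<open>Hom(t,t)\<close> on the compact unitary
  group. Minimizing the squared distance between the Haar moments of a basis and the moments of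
  finitely supported probability measures shows that the Haar moments lie in the closure of the
  latter: moving a near-minimizer slightly towards a point \<open>y\<close> cannot reduce the distance much, and
  averaging this inequality over \<open>y\<close> forces the infimum to be zero. Caratheodory's argument reduces
  each approximating measure to at most \<open>dim Hom(t,t)\<close> points; as \<open>Hom(t,t)\<close> contains the
  constants, no extra point is needed to keep the total mass. By compactness the points and
  weights converge along a subsequence to an exact design.
\<close>

section \<open>Linear relations and simultaneous subsequences\<close>

lemma sum_fun_eval: "(\<Sum>i\<in>I. f i) x = (\<Sum>i\<in>I. f i x)" for f :: "'i \<Rightarrow> 'a \<Rightarrow> complex"
  by (induction I rule: infinite_finite_induct) auto

text \<open>The vectors live in a space of dimension at most \<open>card B\<close>, so there are too
  many of them to be independent. Dependence in \<open>complex_fun\<close> is a property of sets,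
  while the family may repeat a vector; a repetition is its own case and gives the relation with
  coefficients 1 and -1.\<close>

lemma nontrivial_relation:
  fixes e :: "'i \<Rightarrow> 'b \<Rightarrow> complex"
  assumes fin: "finite I" "finite B" and less: "card B < card I"
  shows "\<exists>c. (\<exists>i\<in>I. c i \<noteq> 0) \<and> (\<forall>b\<in>B. (\<Sum>i\<in>I. c i * e i b) = 0)"
proof -
  \<comment> \<open>Cutting off outside \<open>B\<close> places each vector in the span of the
    coordinate functions \<open>\<delta> b\<close>.\<close>
  define e' where "e' i = (\<lambda>b. if b \<in> B then e i b else 0)" for i
  define \<delta> :: "'b \<Rightarrow> 'b \<Rightarrow> complex" where "\<delta> b = (\<lambda>b'. if b' = b then 1 else 0)" for b
  show ?thesis
  proof (cases "inj_on e' I")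
    case False
    then obtain i j where ij: "i \<in> I" "j \<in> I" "i \<noteq> j" "e' i = e' j"
      unfolding inj_on_def by blast
    define c :: "'i \<Rightarrow> complex" where "c k = (if k = i then 1 else 0) - (if k = j then 1 else 0)" for k
    have "(\<Sum>k\<in>I. c k * e k b) = 0" if "b \<in> B" for b
    proof -
      have "e i b = e j b" using fun_cong[OF ij(4), of b] that by (simp add: e'_def)
      moreover have "(\<Sum>k\<in>I. c k * e k b) =
        (\<Sum>k\<in>I. (if k = i then e k b else 0) - (if k = j then e k b else 0))"
        by (rule sum.cong) (auto simp: c_def)
      ultimately show ?thesis using fin ij by (simp add: sum_subtractf)
    qed
    moreover have "c i \<noteq> 0" using ij by (simp add: c_def)
    ultimately show ?thesis using ij(1) by blast
  next
    case True
    have "e' i \<in> complex_fun.span (\<delta> ` B)" for i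
    proof -
      have "e' i = (\<Sum>b\<in>B. fun_scale (e i b) (\<delta> b))"
        using fin(2) by (auto simp: fun_eq_iff sum_fun_eval e'_def fun_scale_def \<delta>_def if_distrib cong: if_cong)
      moreover have "(\<Sum>b\<in>B. fun_scale (e i b) (\<delta> b)) \<in> complex_fun.span (\<delta> ` B)"
        by (intro complex_fun.span_sum complex_fun.span_scale complex_fun.span_base imageI)
      ultimately show ?thesis by simp
    qed
    then have "complex_fun.dependent (e' ` I)"
      using complex_fun.independent_span_bound[of "\<delta> ` B" "e' ` I"] fin less
        card_image[OF True] card_image_le[of B \<delta>] by fastforce
    then obtain u v where u: "v \<in> e' ` I" "u v \<noteq> 0" "(\<Sum>v\<in>e' ` I. fun_scale (u v) v) = 0"
      using complex_fun.dependent_finite[of "e' ` I"] fin by auto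
    have "(\<Sum>i\<in>I. u (e' i) * e i b) = 0" if "b \<in> B" for b
    proof -
      have "(\<Sum>i\<in>I. fun_scale (u (e' i)) (e' i)) b = 0"
        using u(3) sum.reindex[OF True, of "\<lambda>v. fun_scale (u v) v"] by simp
      then show ?thesis using that by (simp add: sum_fun_eval fun_scale_def e'_def)
    qed
    with u show ?thesis by (intro exI[of _ "u \<circ> e'"]) auto
  qed
qed

text \<open>Sequential compactness of a finite power of \<open>S\<close>: the indices are added one
  at a time, each passing to a further subsequence, which preserves the limits already
  obtained.\<close>

lemma compact_convergent_family:
  fixes z :: "nat \<Rightarrow> 'i \<Rightarrow> 'a::metric_space"
  assumes "finite I" "compact S" "\<And>k i. i \<in> I \<Longrightarrow> z k i \<in> S"
  shows "\<exists>r l. strict_mono (r :: nat \<Rightarrow> nat) \<and> (\<forall>i\<in>I. l i \<in> S \<and> (\<lambda>k. z (r k) i) \<longlonglongrightarrow> l i)"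
  using assms(1,3)
proof (induction I rule: finite_induct)
  case empty
  show ?case by (intro exI[of _ id]) (auto simp: strict_mono_id)
next
  case (insert j I)
  then obtain r l where r: "strict_mono (r :: nat \<Rightarrow> nat)"
    "\<And>i. i \<in> I \<Longrightarrow> l i \<in> S" "\<And>i. i \<in> I \<Longrightarrow> (\<lambda>k. z (r k) i) \<longlonglongrightarrow> l i"
    by (metis insertCI)
  have "\<forall>k. z (r k) j \<in> S" using insert.prems by auto
  then obtain s a where s: "strict_mono (s :: nat \<Rightarrow> nat)" "a \<in> S" "(\<lambda>k. z (r (s k)) j) \<longlonglongrightarrow> a"
    using assms(2)[unfolded compact_def, rule_format, of "\<lambda>k. z (r k) j"] by (auto simp: comp_def)
  have "(\<lambda>k. z (r (s k)) i) \<longlonglongrightarrow> l i" if "i \<in> I" for i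
    using LIMSEQ_subseq_LIMSEQ[OF r(3)[OF that] s(1)] by (simp add: comp_def)
  with r s insert.hyps show ?case
    by (intro exI[of _ "r \<circ> s"] exI[of _ "l(j := a)"]) (auto simp: strict_mono_def)
qed

section \<open>Approximating moments by finitely supported measures\<close>

lemma moments_approximable:
  fixes B :: "('a \<Rightarrow> complex) set"
  assumes M: "prob_space M" and B: "finite B" and int: "\<And>b. b \<in> B \<Longrightarrow> integrable M b"
    and K: "\<And>b x. b \<in> B \<Longrightarrow> x \<in> space M \<Longrightarrow> norm (b x) \<le> K" and e: "e > 0"
  shows "\<exists>n x w. (\<forall>i<n. x i \<in> space M \<and> w i \<ge> 0) \<and> (\<Sum>i<n. w i) = 1 \<and>
    (\<Sum>b\<in>B. (norm ((\<integral>x. b x \<partial>M) - (\<Sum>i<n::nat. of_real (w i) * b (x i))))\<^sup>2) < e"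
proof -
  interpret prob_space M by fact
  define m where "m b = (\<integral>x. b x \<partial>M)" for b :: "'a \<Rightarrow> complex"
  define E where "E p = (\<Sum>b\<in>B. (norm (m b - p b))\<^sup>2)" for p
  define P where "P = {p :: ('a \<Rightarrow> complex) \<Rightarrow> complex. \<exists>(n::nat) x w. (\<forall>i<n. x i \<in> space M \<and> w i \<ge> 0) \<and>
    (\<Sum>i<n. w i) = 1 \<and> p = (\<lambda>b. \<Sum>i<n. of_real (w i) * b (x i))}"
  define d where "d = Inf (E ` P)"
  \<comment> \<open>A bound, uniform in the near-minimizer and in the target point, for the
    coefficient of the second-order term in \<open>s\<close>: both moment vectors have entries of
    norm at most \<open>K\<close>.\<close>
  define C where "C = (\<Sum>b\<in>B. (2 * K)\<^sup>2)"
  have C0: "C \<ge> 0" unfolding C_def by (intro sum_nonneg) auto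
  have E0: "E p \<ge> 0" for p unfolding E_def by (intro sum_nonneg) auto
  then have bdd: "bdd_below (E ` P)" by (intro bdd_belowI[of _ 0]) auto
  obtain x0 where x0: "x0 \<in> space M" using not_empty by blast
  have "(\<lambda>b. b x0) \<in> P" unfolding P_def
    by (rule CollectI, rule exI[of _ 1], rule exI[of _ "\<lambda>_. x0"], rule exI[of _ "\<lambda>_. 1"])
      (simp add: x0)
  then have ne: "E ` P \<noteq> {}" by blast
  have move: "(\<lambda>b. (1 - of_real s) * p b + of_real s * b y) \<in> P"
    if p: "p \<in> P" and s: "0 \<le> s" "s \<le> 1" and y: "y \<in> space M" for p s y
  proof -
    obtain n :: nat and x w where nxw: "\<forall>i<n. x i \<in> space M \<and> w i \<ge> 0" "(\<Sum>i<n. w i) = 1"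
      "p = (\<lambda>b. \<Sum>i<n. of_real (w i) * b (x i))"
      using p unfolding P_def by blast
    define x' where "x' = x(n := y)"
    \<comment> \<open>The new point \<open>y\<close> takes the fresh index \<open>n\<close> with
      weight \<open>s\<close>, and the old weights shrink by the factor
      \<open>1 - s\<close>.\<close>
    define w' where "w' i = (if i < n then (1 - s) * w i else s)" for i
    have "(\<Sum>i<n. w' i) = (1 - s) * (\<Sum>i<n. w i)"
      by (simp add: w'_def sum_distrib_left)
    then have "(\<Sum>i<Suc n. w' i) = 1" using nxw(2) by (simp add: w'_def)
    moreover have "\<forall>i<Suc n. x' i \<in> space M \<and> w' i \<ge> 0"
      using nxw(1) s y by (auto simp: x'_def w'_def less_Suc_eq)
    moreover have "(1 - of_real s) * p b + of_real s * b y = (\<Sum>i<Suc n. of_real (w' i) * b (x' i))" for b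
      by (simp add: nxw(3) w'_def x'_def sum_distrib_left mult.assoc)
    ultimately show ?thesis unfolding P_def by blast
  qed
  have bound: "norm (p b) \<le> K" if p: "p \<in> P" and b: "b \<in> B" for p b
  proof -
    obtain n :: nat and x w where nxw: "\<forall>i<n. x i \<in> space M \<and> w i \<ge> 0" "(\<Sum>i<n. w i) = 1"
      "p = (\<lambda>b. \<Sum>i<n. of_real (w i) * b (x i))"
      using p unfolding P_def by blast
    have "norm (p b) \<le> (\<Sum>i<n. w i * K)"
      unfolding nxw(3) using nxw(1) K[OF b]
      by (intro sum_norm_le) (auto simp: norm_mult intro!: mult_left_mono)
    then show ?thesis using nxw(2) by (simp flip: sum_distrib_right)
  qed
  \<comment> \<open>Integrate over \<open>y\<close> the inequality \<open>d \<le> E ((1 - s) p + s y)\<close>, expanded in powers of \<open>s\<close>.\<close>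
  have step: "d - s\<^sup>2 * C \<le> (1 - 2 * s) * E p" if p: "p \<in> P" and s: "0 \<le> s" "s \<le> 1" for p s
  proof -
    \<comment> \<open>\<open>h y\<close> is minus half the derivative of \<open>E\<close> at
      \<open>p\<close> in the direction of the moments of \<open>y\<close>. Since \<open>b y\<close>
      has mean \<open>m b\<close>, averaging over \<open>y\<close> turns it into
      \<open>E p\<close>.\<close>
    define h where "h y = (\<Sum>b\<in>B. Re (cnj (m b - p b) * (b y - p b)))" for y
    have inth: "integrable M h" unfolding h_def using int by (intro Bochner_Integration.integrable_sum) auto
    have "integral\<^sup>L M h = (\<Sum>b\<in>B. Re (cnj (m b - p b) * (m b - p b)))"
      unfolding h_def using int
      by (subst Bochner_Integration.integral_sum) (auto simp: prob_space m_def)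
    also have "\<dots> = E p" unfolding E_def
      unfolding cmod_power2 by (intro sum.cong refl) (simp add: power2_eq_square algebra_simps)
    finally have inth_eq: "integral\<^sup>L M h = E p" .
    have "d - s\<^sup>2 * C - E p \<le> - 2 * s * h y" if y: "y \<in> space M" for y
    proof -
      let ?q = "\<lambda>b. (1 - of_real s) * p b + of_real s * b y"
      have near: "norm (b y - p b) \<le> 2 * K" if "b \<in> B" for b
        using norm_triangle_ineq4[of "b y" "p b"] bound[OF p that] K[OF that y] by simp
      have "d \<le> E ?q" unfolding d_def using move[OF p s y] bdd by (intro cInf_lower) auto
      also have "E ?q = (\<Sum>b\<in>B. (norm (m b - p b))\<^sup>2 - 2 * s * Re (cnj (m b - p b) * (b y - p b))
          + s\<^sup>2 * (norm (b y - p b))\<^sup>2)"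
        unfolding E_def cmod_power2 by (intro sum.cong refl) (simp add: power2_eq_square algebra_simps)
      also have "\<dots> = E p - 2 * s * h y + s\<^sup>2 * (\<Sum>b\<in>B. (norm (b y - p b))\<^sup>2)"
        by (simp only: E_def h_def sum.distrib sum_subtractf sum_distrib_left)
      also have "\<dots> \<le> E p - 2 * s * h y + s\<^sup>2 * C"
        unfolding C_def using near
        by (intro add_left_mono mult_left_mono sum_mono power_mono) auto
      finally show ?thesis by simp
    qed
    then have "d - s\<^sup>2 * C - E p \<le> (\<integral>y. - 2 * s * h y \<partial>M)"
      using inth by (intro integral_ge_const) auto
    then show ?thesis by (simp add: inth_eq algebra_simps)
  qed
  \<comment> \<open>The factor \<open>1 - 2 * s\<close> is positive, so the infimum over
    \<open>p\<close> may be taken in \<open>step\<close>; it gives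
    \<open>d - s^2 * C <= (1 - 2 * s) * d\<close>, from which a factor \<open>s\<close>
    cancels.\<close>
  have key: "2 * d \<le> s * C" if s: "0 < s" "s < 1/2" for s
  proof -
    have "(d - s\<^sup>2 * C) / (1 - 2 * s) \<le> d"
      unfolding d_def using ne
    proof (rule cInf_greatest)
      fix v assume "v \<in> E ` P"
      then show "(Inf (E ` P) - s\<^sup>2 * C) / (1 - 2 * s) \<le> v"
        using step s by (auto simp: d_def divide_le_eq mult.commute)
    qed
    then have "s * (2 * d) \<le> s * (s * C)"
      using s by (simp add: divide_le_eq algebra_simps power2_eq_square)
    then show ?thesis using s by (simp add: mult_le_cancel_left)
  qed
  have "d < e"
  proof (rule ccontr)
    assume "\<not> d < e"
    then have d: "d > 0" using e by simp
    \<comment> \<open>The second entry makes \<open>s * C\<close> at most \<open>d\<close>, against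
      \<open>key\<close>; \<open>C + 1\<close> avoids dividing by zero, and \<open>1/4\<close> keeps
      \<open>s\<close> below \<open>1/2\<close>.\<close>
    define s where "s = min (1/4) (d / (C + 1))"
    have s: "0 < s" "s < 1/2" unfolding s_def using d C0 by auto
    have "s * C \<le> d / (C + 1) * C" unfolding s_def using C0 by (intro mult_right_mono) auto
    also have "\<dots> \<le> d" using d C0 by (simp add: field_simps)
    finally show False using key[OF s] d by simp
  qed
  then obtain p where "p \<in> P" "E p < e"
    using cInf_lessD[OF ne] unfolding d_def by blast
  then show ?thesis unfolding P_def E_def m_def by blast
qed

section \<open>Reducing the number of points\<close>

text \<open>More than \<open>card B\<close> points satisfy a linear relation, and subtracting a
  suitable real multiple of it removes a point without changing any moment. Counting real equations
  would only give the bound \<open>2 * card B\<close>; closure of the span under conjugation makes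
  the complex dimension suffice.\<close>

lemma caratheodory_reduction:
  fixes B :: "('a \<Rightarrow> complex) set" and x :: "'i \<Rightarrow> 'a" and w :: "'i \<Rightarrow> real"
  assumes B: "finite B" and one: "(\<lambda>x. if x \<in> S then 1 else 0) \<in> complex_fun.span B"
    and cnj: "\<And>f. f \<in> B \<Longrightarrow> (\<lambda>x. cnj (f x)) \<in> complex_fun.span B"
    and I: "finite I" "\<And>i. i \<in> I \<Longrightarrow> x i \<in> S" "\<And>i. i \<in> I \<Longrightarrow> w i \<ge> 0"
  shows "\<exists>J w'. J \<subseteq> I \<and> card J \<le> card B \<and> (\<forall>i\<in>J. w' i \<ge> 0) \<and>
    (\<forall>f\<in>complex_fun.span B. (\<Sum>i\<in>J. of_real (w' i) * f (x i)) = (\<Sum>i\<in>I. of_real (w i) * f (x i)))"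
  using I
proof (induction I arbitrary: w rule: finite_psubset_induct)
  case (psubset I)
  show ?case
  proof (cases "card I \<le> card B")
    case True
    then show ?thesis using psubset.prems by (intro exI[of _ I] exI[of _ w]) auto
  next
    case False
    then obtain c where c: "\<exists>i\<in>I. c i \<noteq> 0" "\<And>b. b \<in> B \<Longrightarrow> (\<Sum>i\<in>I. c i * b (x i)) = 0"
      using nontrivial_relation[OF psubset.hyps(1) B, of "\<lambda>i b. b (x i)"] by auto
    \<comment> \<open>The relation is extended to the span because the conjugates of elements of
      \<open>B\<close> are only known to lie there.\<close>
    have rel: "(\<Sum>i\<in>I. c i * f (x i)) = 0" if "f \<in> complex_fun.span B" for f
      using that
    proof (rule complex_fun.span_induct)
      show "complex_fun.subspace {f. (\<Sum>i\<in>I. c i * f (x i)) = 0}"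
        by (rule complex_fun.subspaceI)
          (auto simp: fun_scale_def distrib_left sum.distrib mult.left_commute simp flip: sum_distrib_left)
    qed (use c in auto)
    \<comment> \<open>Since \<open>span B\<close> is closed under conjugation, so is the space of relations; hence real and
      imaginary parts of a relation are relations, and a real one exists.\<close>
    have rel_cnj: "(\<Sum>i\<in>I. cnj (c i) * b (x i)) = 0" if "b \<in> B" for b
    proof -
      have "(\<Sum>i\<in>I. cnj (c i) * b (x i)) = cnj (\<Sum>i\<in>I. c i * cnj (b (x i)))" by simp
      also have "\<dots> = 0" using rel[OF cnj[OF that]] by simp
      finally show ?thesis .
    qed
    obtain v :: "'i \<Rightarrow> real" where v: "\<exists>i\<in>I. v i \<noteq> 0" "\<And>b. b \<in> B \<Longrightarrow> (\<Sum>i\<in>I. of_real (v i) * b (x i)) = 0"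
    proof (cases "\<exists>i\<in>I. Re (c i) \<noteq> 0")
      case True
      have "(\<Sum>i\<in>I. of_real (Re (c i)) * b (x i)) = 0" if "b \<in> B" for b
      proof -
        have "(\<Sum>i\<in>I. of_real (Re (c i)) * b (x i)) =
            (\<Sum>i\<in>I. c i * b (x i) + cnj (c i) * b (x i)) / 2"
          unfolding sum_divide_distrib
          by (intro sum.cong refl) (auto simp: complex_eq_iff field_simps)
        then show ?thesis using c(2)[OF that] rel_cnj[OF that] by (simp add: sum.distrib)
      qed
      then show ?thesis by (rule that[OF True])
    next
      \<comment> \<open>Here the relation is purely imaginary, so multiplying it by minus the
        imaginary unit makes it real.\<close>
      case False
      have Im_c: "of_real (Im (c i)) = - \<i> * c i" if "i \<in> I" for i
      proof -
        have "Re (c i) = 0" using False that by blast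
        then show ?thesis by (intro complex_eqI) simp_all
      qed
      have "(\<Sum>i\<in>I. of_real (Im (c i)) * b (x i)) = 0" if "b \<in> B" for b
      proof -
        have "(\<Sum>i\<in>I. of_real (Im (c i)) * b (x i)) = (\<Sum>i\<in>I. - \<i> * (c i * b (x i)))"
          by (intro sum.cong refl) (simp add: Im_c)
        also have "\<dots> = - \<i> * (\<Sum>i\<in>I. c i * b (x i))" by (rule sum_distrib_left[symmetric])
        finally show ?thesis using c(2)[OF that] by simp
      qed
      moreover have "\<exists>i\<in>I. Im (c i) \<noteq> 0" using c(1) False by (metis complex_eqI zero_complex.sel)
      ultimately show ?thesis by (intro that[of "\<lambda>i. Im (c i)"])
    qed
    have relv: "(\<Sum>i\<in>I. of_real (v i) * f (x i)) = 0" if "f \<in> complex_fun.span B" for f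
      using that
    proof (rule complex_fun.span_induct)
      show "complex_fun.subspace {f. (\<Sum>i\<in>I. of_real (v i) * f (x i)) = 0}"
        by (rule complex_fun.subspaceI)
          (auto simp: fun_scale_def distrib_left sum.distrib mult.left_commute simp flip: sum_distrib_left)
    qed (use v in auto)
    \<comment> \<open>Testing the relation on the constant function shows that its coefficients sum
      to zero. As they are not all zero, one of them is positive.\<close>
    have "(\<Sum>i\<in>I. of_real (v i)) = (0::complex)"
      using relv[OF one] psubset.prems by simp
    then have "(\<Sum>i\<in>I. v i) = 0" by (simp flip: of_real_sum)
    then have "\<exists>i\<in>I. v i > 0"
      using v(1) sum_nonneg_eq_0_iff[of I "\<lambda>i. - v i"] psubset.hyps(1)
      by (auto simp: sum_negf not_less) (metis linorder_not_less order_less_imp_le)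
    then have ne: "{i\<in>I. v i > 0} \<noteq> {}" by blast
    \<comment> \<open>The smallest ratio is the largest multiple of \<open>v\<close> that can be
      subtracted while all weights stay nonnegative; the weight at \<open>k\<close> then becomes
      zero.\<close>
    obtain k where k: "k \<in> I" "v k > 0" and kmin: "\<And>i. i \<in> I \<Longrightarrow> v i > 0 \<Longrightarrow> w k / v k \<le> w i / v i"
      using ex_is_arg_min_if_finite[OF _ ne, of "\<lambda>i. w i / v i"] psubset.hyps(1)
      by (auto simp: is_arg_min_linorder)
    define u where "u i = w i - w k / v k * v i" for i
    have u0: "u i \<ge> 0" if "i \<in> I" for i
    proof (cases "v i > 0")
      case True
      then show ?thesis using kmin[OF that] by (simp add: u_def le_divide_eq)
    next
      case False
      have "w k / v k * v i \<le> 0"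
        using False k psubset.prems by (intro mult_nonneg_nonpos) auto
      then show ?thesis using psubset.prems(2)[OF that] by (simp add: u_def)
    qed
    have uk: "u k = 0" using k by (simp add: u_def)
    have usum: "(\<Sum>i\<in>I - {k}. of_real (u i) * f (x i)) = (\<Sum>i\<in>I. of_real (w i) * f (x i))"
      if "f \<in> complex_fun.span B" for f
    proof -
      have "(\<Sum>i\<in>I - {k}. of_real (u i) * f (x i)) = (\<Sum>i\<in>I. of_real (u i) * f (x i))"
        using uk psubset.hyps(1) by (intro sum.mono_neutral_left) auto
      also have "\<dots> = (\<Sum>i\<in>I. of_real (w i) * f (x i) - of_real (w k / v k) * (of_real (v i) * f (x i)))"
        unfolding u_def by (intro sum.cong refl) (simp add: algebra_simps)
      also have "\<dots> = (\<Sum>i\<in>I. of_real (w i) * f (x i))"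
        unfolding sum_subtractf sum_distrib_left[symmetric] using relv[OF that] by simp
      finally show ?thesis .
    qed
    have "I - {k} \<subset> I" using k by blast
    from psubset.IH[OF this, of u] u0 psubset.prems obtain J w' where
      J: "J \<subseteq> I - {k}" "card J \<le> card B" "\<forall>i\<in>J. w' i \<ge> 0"
      "\<forall>f\<in>complex_fun.span B. (\<Sum>i\<in>J. of_real (w' i) * f (x i)) = (\<Sum>i\<in>I - {k}. of_real (u i) * f (x i))"
      by auto
    have "\<forall>f\<in>complex_fun.span B. (\<Sum>i\<in>J. of_real (w' i) * f (x i)) = (\<Sum>i\<in>I. of_real (w i) * f (x i))"
      using J(4) usum by simp
    with J(1-3) show ?thesis by blast
  qed
qed

section \<open>Tchakaloff's theorem\<close>

text \<open>The reduction comes before the limit: a bound on the number of points common to all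
  approximations is what allows points and weights to converge along one subsequence.\<close>

theorem tchakaloff:
  fixes B :: "('a::metric_space \<Rightarrow> complex) set"
  assumes M: "prob_space M" and S: "space M = S" "compact S" and B: "finite B"
    and int: "\<And>b. b \<in> B \<Longrightarrow> integrable M b" and cont: "\<And>b. b \<in> B \<Longrightarrow> continuous_on S b"
    and one: "(\<lambda>x. if x \<in> S then 1 else 0) \<in> complex_fun.span B"
    and cnj: "\<And>f. f \<in> B \<Longrightarrow> (\<lambda>x. cnj (f x)) \<in> complex_fun.span B"
  shows "\<exists>X w. finite X \<and> X \<subseteq> S \<and> card X \<le> card B \<and> (\<forall>x\<in>X. w x > 0) \<and> (\<Sum>x\<in>X. w x) = 1 \<and>
    (\<forall>b\<in>B. (\<Sum>x\<in>X. of_real (w x) * b x) = (\<integral>x. b x \<partial>M))"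
proof -
  define N where "N = card B"
  obtain x0 where x0: "x0 \<in> S" using prob_space.not_empty[OF M] S(1) by blast
  have "bounded (\<Union>b\<in>B. b ` S)"
    using B S(2) cont by (intro bounded_UN) (auto intro!: compact_imp_bounded compact_continuous_image)
  then obtain K where K: "\<And>b x. b \<in> B \<Longrightarrow> x \<in> space M \<Longrightarrow> norm (b x) \<le> K"
    unfolding bounded_iff S(1) by blast
  \<comment> \<open>Every approximation is indexed by exactly \<open>{..<N}\<close>, so that all of
    them lie in one finite power of a compact set.\<close>
  define Q where "Q k x w \<longleftrightarrow> (\<forall>i<N. x i \<in> S \<and> 0 \<le> w i) \<and> (\<Sum>i<N. w i) = 1 \<and>
    (\<Sum>b\<in>B. (norm ((\<integral>x. b x \<partial>M) - (\<Sum>i<N. of_real (w i) * b (x i))))\<^sup>2) < inverse (real (Suc k))"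
    for k and x :: "nat \<Rightarrow> 'a" and w :: "nat \<Rightarrow> real"
  have "\<exists>x w. Q k x w" for k
  proof -
    obtain n :: nat and x w where nxw: "\<And>i. i < n \<Longrightarrow> x i \<in> S \<and> w i \<ge> 0" "(\<Sum>i<n. w i) = 1"
      "(\<Sum>b\<in>B. (norm ((\<integral>x. b x \<partial>M) - (\<Sum>i<n. of_real (w i) * b (x i))))\<^sup>2) < inverse (real (Suc k))"
      using moments_approximable[OF M B, of K "inverse (real (Suc k))"] int K S(1) by auto
    obtain J w' where J: "J \<subseteq> {..<n}" "card J \<le> N" "\<forall>i\<in>J. w' i \<ge> 0"
      "\<And>f. f \<in> complex_fun.span B \<Longrightarrow>
        (\<Sum>i\<in>J. of_real (w' i) * f (x i)) = (\<Sum>i<n. of_real (w i) * f (x i))"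
      using caratheodory_reduction[OF B one, of "{..<n}" x w] cnj nxw(1) unfolding N_def by auto
    have finJ: "finite J" using J(1) finite_subset by blast
    then obtain g where g: "bij_betw g {..<card J} J"
      using ex_bij_betw_nat_finite[of J] by (auto simp: atLeast0LessThan)
    then have gJ: "g i \<in> J" if "i < card J" for i using that by (auto simp: bij_betw_def)
    then have gn: "g i < n" if "i < card J" for i using that J(1) by auto
    \<comment> \<open>The reduced family may have fewer than \<open>N\<close> points; it is padded
      with copies of \<open>x0\<close> of weight zero.\<close>
    define y where "y i = (if i < card J then x (g i) else x0)" for i
    define u where "u i = (if i < card J then w' (g i) else 0)" for i
    have sum: "(\<Sum>i<N. of_real (u i) * f (y i)) = (\<Sum>i<n. of_real (w i) * f (x i))"
      if "f \<in> complex_fun.span B" for f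
    proof -
      have "(\<Sum>i<N. of_real (u i) * f (y i)) = (\<Sum>i<card J. of_real (w' (g i)) * f (x (g i)))"
        using J(2) by (intro sum.mono_neutral_cong_right) (auto simp: u_def y_def)
      also have "\<dots> = (\<Sum>i\<in>J. of_real (w' i) * f (x i))"
        by (rule sum.reindex_bij_betw[OF g])
      finally show ?thesis using J(4)[OF that] by simp
    qed
    have y: "\<forall>i<N. y i \<in> S \<and> 0 \<le> u i"
      using gJ gn nxw(1) x0 J(3) by (auto simp: y_def u_def)
    \<comment> \<open>The constant function lies in the span, so its preserved moment says that the
      total mass is still 1.\<close>
    have "(\<Sum>i<N. of_real (u i)) = (\<Sum>i<n. of_real (w i) :: complex)"
      using sum[OF one] y nxw(1) by (simp cong: if_cong)
    then have "of_real (\<Sum>i<N. u i) = (of_real (\<Sum>i<n. w i) :: complex)" by simp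
    then have "(\<Sum>i<N. u i) = 1" using nxw(2) by (simp only: of_real_eq_iff)
    moreover have "(\<Sum>b\<in>B. (norm ((\<integral>x. b x \<partial>M) - (\<Sum>i<N. of_real (u i) * b (y i))))\<^sup>2)
        < inverse (real (Suc k))"
      using nxw(3) by (simp add: sum[OF complex_fun.span_base] cong: sum.cong)
    ultimately show ?thesis using y unfolding Q_def by blast
  qed
  then obtain xs ws where "\<And>k. Q k (xs k) (ws k)" by metis
  then have xs: "i < N \<Longrightarrow> xs k i \<in> S" and ws: "i < N \<Longrightarrow> 0 \<le> ws k i"
    and ws_sum: "(\<Sum>i<N. ws k i) = 1"
    and close: "(\<Sum>b\<in>B. (norm ((\<integral>x. b x \<partial>M) - (\<Sum>i<N. of_real (ws k i) * b (xs k i))))\<^sup>2)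
      < inverse (real (Suc k))" for i k
    unfolding Q_def by blast+
  \<comment> \<open>This confines the weights to the compact interval \<open>{0..1}\<close>.\<close>
  have ws1: "ws k i \<le> 1" if "i < N" for k i
    using member_le_sum[of i "{..<N}" "ws k"] ws ws_sum that by simp
  have "\<exists>r l. strict_mono (r :: nat \<Rightarrow> nat) \<and> (\<forall>i\<in>{..<N}. l i \<in> S \<times> {0..1::real} \<and>
      (\<lambda>k. (xs (r k) i, ws (r k) i)) \<longlonglongrightarrow> l i)"
    using compact_convergent_family[of "{..<N}" "S \<times> {0..1::real}" "\<lambda>k i. (xs k i, ws k i)"]
      xs ws ws1 S(2) by (auto intro: compact_Times)
  then obtain r l where r: "strict_mono (r :: nat \<Rightarrow> nat)" and l: "\<And>i. i < N \<Longrightarrow> l i \<in> S \<times> {0..1::real}"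
    and lim: "\<And>i. i < N \<Longrightarrow> (\<lambda>k. (xs (r k) i, ws (r k) i)) \<longlonglongrightarrow> l i"
    by auto
  define y where "y i = fst (l i)" for i
  define u where "u i = snd (l i)" for i
  have y: "y i \<in> S" and u: "u i \<ge> 0" if "i < N" for i using l[OF that] by (auto simp: y_def u_def)
  have limx: "(\<lambda>k. xs (r k) i) \<longlonglongrightarrow> y i" and limw: "(\<lambda>k. ws (r k) i) \<longlonglongrightarrow> u i" if "i < N" for i
    using tendsto_fst[OF lim[OF that]] tendsto_snd[OF lim[OF that]] by (simp_all add: y_def u_def)
  have usum: "(\<Sum>i<N. u i) = 1"
  proof (rule LIMSEQ_unique)
    show "(\<lambda>k. \<Sum>i<N. ws (r k) i) \<longlonglongrightarrow> (\<Sum>i<N. u i)" using limw by (intro tendsto_sum) auto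
  qed (simp add: ws_sum)
  have exact: "(\<Sum>i<N. of_real (u i) * b (y i)) = (\<integral>x. b x \<partial>M)" if b: "b \<in> B" for b
  proof (rule LIMSEQ_unique)
    have "(\<lambda>k. b (xs (r k) i)) \<longlonglongrightarrow> b (y i)" if "i < N" for i
      using continuous_on_tendsto_compose[OF cont[OF b] limx[OF that] y[OF that]] xs that by simp
    then show "(\<lambda>k. \<Sum>i<N. of_real (ws (r k) i) * b (xs (r k) i)) \<longlonglongrightarrow> (\<Sum>i<N. of_real (u i) * b (y i))"
      using limw by (intro tendsto_sum tendsto_mult tendsto_of_real) auto
    let ?D = "\<lambda>k. (\<integral>x. b x \<partial>M) - (\<Sum>i<N. of_real (ws k i) * b (xs k i))"
    have "(norm (?D k))\<^sup>2 \<le> inverse (real (Suc k))" for k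
      using close[of k] member_le_sum[OF b, of "\<lambda>b. (norm ((\<integral>x. b x \<partial>M) - (\<Sum>i<N. of_real (ws k i) * b (xs k i))))\<^sup>2"] B
      by auto
    then have "(\<lambda>k. (norm (?D k))\<^sup>2) \<longlonglongrightarrow> 0"
      by (intro tendsto_sandwich[OF _ _ tendsto_const LIMSEQ_inverse_real_of_nat]) auto
    from tendsto_real_sqrt[OF this] have "?D \<longlonglongrightarrow> 0" by (simp add: tendsto_norm_zero_iff)
    from LIMSEQ_subseq_LIMSEQ[OF this r] have "(\<lambda>k. ?D (r k)) \<longlonglongrightarrow> 0" by (simp add: comp_def)
    from tendsto_diff[OF tendsto_const this, of "\<integral>x. b x \<partial>M"]
    show "(\<lambda>k. \<Sum>i<N. of_real (ws (r k) i) * b (xs (r k) i)) \<longlonglongrightarrow> (\<integral>x. b x \<partial>M)" by simp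
  qed
  \<comment> \<open>In the limit weights may vanish and points may coincide. Indices of weight zero
    are dropped and the weights of equal points are added up, which gives a set with strictly
    positive weights.\<close>
  define I where "I = {i. i < N \<and> u i > 0}"
  define X where "X = y ` I"
  define w where "w x = (\<Sum>i | i \<in> I \<and> y i = x. u i)" for x
  have I: "finite I" by (simp add: I_def)
  have restr: "(\<Sum>i\<in>I. of_real (u i) * f (y i)) = (\<Sum>i<N. of_real (u i) * f (y i))"
    for f :: "'a \<Rightarrow> 'b::real_normed_field"
    using u by (intro sum.mono_neutral_left) (auto simp: I_def order_less_le)
  \<comment> \<open>Kept general in the codomain: the real case yields the total mass, the complex
    case the moments.\<close>
  have wsum: "(\<Sum>x\<in>X. of_real (w x) * f x) = (\<Sum>i<N. of_real (u i) * f (y i))"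
    for f :: "'a \<Rightarrow> 'b::real_normed_field"
  proof -
    have "(\<Sum>x\<in>X. of_real (w x) * f x) = (\<Sum>x\<in>X. \<Sum>i | i \<in> I \<and> y i = x. of_real (u i) * f (y i))"
      by (intro sum.cong refl) (simp add: w_def sum_distrib_right)
    also have "\<dots> = (\<Sum>i\<in>I. of_real (u i) * f (y i))"
      using I by (intro sum.group) (auto simp: X_def)
    finally show ?thesis using restr by simp
  qed
  have "card X \<le> card B"
    using card_image_le[OF I, of y] card_mono[of "{..<N}" I] unfolding X_def N_def[symmetric]
    by (fastforce simp: I_def)
  moreover have "finite X" "X \<subseteq> S" using I y by (auto simp: X_def I_def)
  moreover have "w x > 0" if "x \<in> X" for x
    unfolding w_def using that I by (intro sum_pos) (auto simp: X_def I_def)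
  moreover have "(\<Sum>x\<in>X. w x) = 1" using wsum[of "\<lambda>_. 1::real"] usum by simp
  ultimately show ?thesis using exact by (intro exI[of _ X] exI[of _ w]) (simp add: wsum)
qed

section \<open>Compactness of the unitary group\<close>

lemma ctranspose_nth [simp]: "ctranspose A $ i $ j = cnj (A $ j $ i)"
  by (simp add: ctranspose_def)

lemma ctranspose_ctranspose [simp]: "ctranspose (ctranspose A) = A"
  by (simp add: vec_eq_iff)

lemma mat_1_unitary: "mat 1 \<in> unitary_group"
proof -
  have "ctranspose (mat 1 :: complex ^ 'n ^ 'n) = mat 1" by (simp add: vec_eq_iff mat_def)
  then show ?thesis by (simp add: unitary_group_def)
qed

text \<open>A diagonal entry of \<open>U ** ctranspose U\<close>. It bounds the entries of
  \<open>U\<close> in the compactness proof, and it writes 1 as a polynomial of degree one in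
  \<open>U\<close> and one in its adjoint.\<close>

lemma unitary_row_norm:
  assumes "U \<in> unitary_group"
  shows "(\<Sum>j\<in>UNIV. U $ i $ j * cnj (U $ i $ j)) = 1"
proof -
  have "(U ** ctranspose U) $ i $ i = 1" using assms by (simp add: unitary_group_def mat_def)
  then show ?thesis by (simp add: matrix_matrix_mult_def)
qed

lemma compact_unitary_group: "compact (unitary_group :: (complex ^ 'n ^ 'n) set)"
  unfolding compact_eq_bounded_closed
proof
  have "norm U \<le> (\<Sum>i\<in>(UNIV :: 'n set). \<Sum>j\<in>(UNIV :: 'n set). 1)"
    if U: "U \<in> unitary_group" for U :: "complex ^ 'n ^ 'n"
  proof -
    have entry: "norm (U $ i $ j) \<le> 1" for i j
    proof -
      have "of_real (\<Sum>j\<in>UNIV. (norm (U $ i $ j))\<^sup>2) = (1 :: complex)"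
        using unitary_row_norm[OF U, of i] by (simp add: complex_norm_square del: of_real_power)
      then have "(\<Sum>j\<in>UNIV. (norm (U $ i $ j))\<^sup>2) = 1" by (simp only: of_real_eq_1_iff)
      then have "(norm (U $ i $ j))\<^sup>2 \<le> 1\<^sup>2"
        using member_le_sum[of j UNIV "\<lambda>j. (norm (U $ i $ j))\<^sup>2"] by simp
      then show ?thesis by (rule power2_le_imp_le) simp
    qed
    have "norm (U $ i) \<le> (\<Sum>j\<in>(UNIV :: 'n set). 1)" for i
    proof -
      have "norm (U $ i) \<le> (\<Sum>j\<in>UNIV. norm (U $ i $ j))"
        unfolding norm_vec_def[of "U $ i"] by (rule L2_set_le_sum) simp
      also have "\<dots> \<le> (\<Sum>j\<in>(UNIV :: 'n set). 1)" by (intro sum_mono entry)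
      finally show ?thesis .
    qed
    then have "(\<Sum>i\<in>UNIV. norm (U $ i)) \<le> (\<Sum>i\<in>(UNIV :: 'n set). \<Sum>j\<in>(UNIV :: 'n set). 1)"
      by (rule sum_mono)
    then show ?thesis
      unfolding norm_vec_def[of U] by (intro order.trans[OF L2_set_le_sum]) simp_all
  qed
  then show "bounded (unitary_group :: (complex ^ 'n ^ 'n) set)" unfolding bounded_iff by blast
  \<comment> \<open>Entrywise, the group is cut out by equations between continuous functions, hence
    closed.\<close>
  have eq: "unitary_group = {U :: complex ^ 'n ^ 'n. \<forall>i j.
      (U ** ctranspose U) $ i $ j = mat 1 $ i $ j \<and> (ctranspose U ** U) $ i $ j = mat 1 $ i $ j}"
    by (simp add: unitary_group_def vec_eq_iff) blast
  show "closed (unitary_group :: (complex ^ 'n ^ 'n) set)"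
    unfolding eq matrix_matrix_mult_def vec_lambda_beta ctranspose_nth
    by (intro closed_Collect_all closed_Collect_conj closed_Collect_eq continuous_intros)
qed

section \<open>The space Hom(t,t): monomials, conjugation, constants, tensor entries\<close>

definition hom_monomial ::
  "('n::finite \<Rightarrow> 'n \<Rightarrow> nat) \<Rightarrow> ('n \<Rightarrow> 'n \<Rightarrow> nat) \<Rightarrow> complex ^ 'n ^ 'n \<Rightarrow> complex" where
  "hom_monomial \<alpha> \<beta> =
     (\<lambda>U. if U \<in> unitary_group then matrix_monomial \<alpha> U * matrix_monomial \<beta> (ctranspose U) else 0)"

definition hom_monomials :: "nat \<Rightarrow> (complex ^ 'n ^ 'n \<Rightarrow> complex) set" where
  "hom_monomials t = (\<lambda>(\<alpha>, \<beta>). hom_monomial \<alpha> \<beta>) ` (degree_exponents t \<times> degree_exponents t)"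

lemma finite_hom_monomials: "finite (hom_monomials t)"
  by (simp add: hom_monomials_def finite_degree_exponents)

lemma hom_monomialsE:
  assumes "f \<in> hom_monomials t"
  obtains \<alpha> \<beta> where "\<alpha> \<in> degree_exponents t" "\<beta> \<in> degree_exponents t" "f = hom_monomial \<alpha> \<beta>"
  using assms by (auto simp: hom_monomials_def)

lemma hom_monomial_mem:
  "\<alpha> \<in> degree_exponents t \<Longrightarrow> \<beta> \<in> degree_exponents t \<Longrightarrow> hom_monomial \<alpha> \<beta> \<in> hom_monomials t"
  by (auto simp: hom_monomials_def)

text \<open>This form makes available a basis chosen among the monomials, and induction over the
  span.\<close>

lemma hom_space_eq_span:
  "(hom_space t :: (complex ^ 'n ^ 'n \<Rightarrow> complex) set) = complex_fun.span (hom_monomials t)"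
proof
  show "hom_space t \<subseteq> complex_fun.span (hom_monomials t :: (complex ^ 'n ^ 'n \<Rightarrow> complex) set)"
  proof
    fix f :: "complex ^ 'n ^ 'n \<Rightarrow> complex" assume "f \<in> hom_space t"
    then obtain c where "f = (\<lambda>U. if U \<in> unitary_group then \<Sum>\<alpha>\<in>degree_exponents t. \<Sum>\<beta>\<in>degree_exponents t.
       c \<alpha> \<beta> * matrix_monomial \<alpha> U * matrix_monomial \<beta> (ctranspose U) else 0)"
      unfolding hom_space_def by blast
    then have f: "f = (\<Sum>\<alpha>\<in>degree_exponents t. \<Sum>\<beta>\<in>degree_exponents t.
        fun_scale (c \<alpha> \<beta>) (hom_monomial \<alpha> \<beta>))"
      by (auto simp: fun_eq_iff sum_fun_eval fun_scale_def hom_monomial_def mult.assoc)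
    show "f \<in> complex_fun.span (hom_monomials t)"
      unfolding f by (intro complex_fun.span_sum complex_fun.span_scale complex_fun.span_base hom_monomial_mem)
  qed
  have "hom_monomial \<alpha> \<beta> \<in> hom_space t"
    if "\<alpha> \<in> degree_exponents t" "\<beta> \<in> degree_exponents t" for \<alpha> \<beta> :: "'n \<Rightarrow> 'n \<Rightarrow> nat"
    unfolding hom_space_def
  proof (rule CollectI, rule exI[of _ "\<lambda>\<alpha>' \<beta>'. if \<alpha>' = \<alpha> then if \<beta>' = \<beta> then 1 else 0 else 0"])
    show "hom_monomial \<alpha> \<beta> = (\<lambda>U. if U \<in> unitary_group then
        \<Sum>\<alpha>'\<in>degree_exponents t. \<Sum>\<beta>'\<in>degree_exponents t.
          (if \<alpha>' = \<alpha> then if \<beta>' = \<beta> then 1 else 0 else 0) *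
          matrix_monomial \<alpha>' U * matrix_monomial \<beta>' (ctranspose U) else 0)"
    proof
      fix U
      have inner: "(\<Sum>\<beta>'\<in>degree_exponents t. (if \<alpha>' = \<alpha> then if \<beta>' = \<beta> then 1 else 0 else 0) *
          matrix_monomial \<alpha>' U * matrix_monomial \<beta>' (ctranspose U)) =
          (if \<alpha>' = \<alpha> then matrix_monomial \<alpha> U * matrix_monomial \<beta> (ctranspose U) else 0)" for \<alpha>'
        using that(2) finite_degree_exponents[of t, where ?'n = 'n]
        by (simp add: if_distrib[of "\<lambda>x. x * _"] cong: if_cong)
      show "hom_monomial \<alpha> \<beta> U = (if U \<in> unitary_group then
        \<Sum>\<alpha>'\<in>degree_exponents t. \<Sum>\<beta>'\<in>degree_exponents t.
          (if \<alpha>' = \<alpha> then if \<beta>' = \<beta> then 1 else 0 else 0) *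
          matrix_monomial \<alpha>' U * matrix_monomial \<beta>' (ctranspose U) else 0)"
        using that(1) finite_degree_exponents[of t, where ?'n = 'n] by (simp add: inner hom_monomial_def)
    qed
  qed
  then show "complex_fun.span (hom_monomials t :: (complex ^ 'n ^ 'n \<Rightarrow> complex) set) \<subseteq> hom_space t"
    by (intro complex_fun.span_minimal hom_space_subspace) (auto elim!: hom_monomialsE)
qed

text \<open>Conjugation turns entries of \<open>U\<close> into entries of
  \<open>ctranspose U\<close> with indices swapped. It therefore transposes both exponent matrices
  and exchanges them, which stays in the family as both degrees equal \<open>t\<close>.\<close>

lemma cnj_hom_monomials:
  assumes "f \<in> hom_monomials t"
  shows "(\<lambda>U. cnj (f U)) \<in> hom_monomials t"
proof -
  obtain \<alpha> \<beta> where ab: "\<alpha> \<in> degree_exponents t" "\<beta> \<in> degree_exponents t" "f = hom_monomial \<alpha> \<beta>"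
    using assms by (rule hom_monomialsE)
  have deg: "(\<lambda>i j. \<gamma> j i) \<in> degree_exponents t" if "\<gamma> \<in> degree_exponents t" for \<gamma> :: "'a \<Rightarrow> 'a \<Rightarrow> nat"
    using that sum.swap[of \<gamma> UNIV UNIV] by (simp add: degree_exponents_def)
  have mono: "cnj (matrix_monomial \<gamma> A) = matrix_monomial (\<lambda>i j. \<gamma> j i) (ctranspose A)"
    for \<gamma> and A :: "complex ^ 'a ^ 'a"
    unfolding matrix_monomial_def by (subst prod.swap) simp
  have "(\<lambda>U. cnj (f U)) = hom_monomial (\<lambda>i j. \<beta> j i) (\<lambda>i j. \<alpha> j i)"
    by (auto simp: ab(3) hom_monomial_def mono mult.commute)
  then show ?thesis using deg ab by (auto intro: hom_monomial_mem)
qed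

lemma continuous_on_hom_monomials:
  assumes "f \<in> hom_monomials t"
  shows "continuous_on unitary_group f"
proof -
  obtain \<alpha> \<beta> where "f = hom_monomial \<alpha> \<beta>" using assms by (rule hom_monomialsE)
  moreover have "continuous_on unitary_group (\<lambda>U. matrix_monomial \<alpha> U * matrix_monomial \<beta> (ctranspose U))"
    unfolding matrix_monomial_def ctranspose_nth by (intro continuous_intros)
  ultimately show ?thesis by (simp add: hom_monomial_def cong: continuous_on_cong)
qed

lemma matrix_monomial_increment:
  fixes \<alpha> :: "'n::finite \<Rightarrow> 'n \<Rightarrow> nat" and i j :: 'n
  defines "\<alpha>' \<equiv> \<lambda>k l. \<alpha> k l + (if k = i then if l = j then 1 else 0 else 0)"
  shows "matrix_monomial \<alpha>' A = A $ i $ j * matrix_monomial \<alpha> A"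
    and "\<alpha> \<in> degree_exponents t \<Longrightarrow> \<alpha>' \<in> degree_exponents (Suc t)"
proof -
  have inner: "(\<Prod>l\<in>UNIV. (A $ k $ l) ^ (if l = j then 1 else 0)) = A $ k $ j" for k
    by (simp add: if_distrib[of "power _"] cong: if_cong)
  have "(\<Prod>k\<in>UNIV. \<Prod>l\<in>UNIV. (A $ k $ l) ^ (if k = i then if l = j then 1 else 0 else 0)) =
      (\<Prod>k\<in>UNIV. if k = i then A $ k $ j else 1)"
    using inner by (intro prod.cong refl) auto
  also have "\<dots> = A $ i $ j" by simp
  finally have outer: "(\<Prod>k\<in>UNIV. \<Prod>l\<in>UNIV. (A $ k $ l) ^ (if k = i then if l = j then 1 else 0 else 0)) =
      A $ i $ j" .
  show "matrix_monomial \<alpha>' A = A $ i $ j * matrix_monomial \<alpha> A"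
    unfolding matrix_monomial_def \<alpha>'_def power_add prod.distrib outer by (rule mult.commute)
  have "(\<Sum>k\<in>UNIV. \<Sum>l\<in>UNIV. (if k = i then if l = j then 1 else 0 else 0)) =
      (\<Sum>k\<in>(UNIV :: 'n set). if k = i then \<Sum>l\<in>(UNIV :: 'n set). if l = j then 1 else 0 else (0 :: nat))"
    by (intro sum.cong refl) auto
  then show "\<alpha> \<in> degree_exponents t \<Longrightarrow> \<alpha>' \<in> degree_exponents (Suc t)"
    by (simp add: degree_exponents_def \<alpha>'_def sum.distrib)
qed

text \<open>The condition is linear in \<open>f\<close>, so monomials suffice, and there one
  exponent on each side goes up by one. This is the inductive step in \<open>t\<close> both for the
  constants and for the tensor entries.\<close>

lemma hom_space_mult:
  fixes f :: "complex ^ 'n ^ 'n \<Rightarrow> complex"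
  assumes "f \<in> hom_space t"
  shows "(\<lambda>U. U $ i $ j * ctranspose U $ k $ l * f U) \<in> hom_space (Suc t)"
  using assms unfolding hom_space_eq_span[of t]
proof (rule complex_fun.span_induct)
  show "complex_fun.subspace {f. (\<lambda>U. U $ i $ j * ctranspose U $ k $ l * f U) \<in> hom_space (Suc t)}"
  proof (rule complex_fun.subspaceI; clarsimp simp del: ctranspose_nth)
    show "(\<lambda>U. 0) \<in> hom_space (Suc t)"
      using complex_fun.subspace_0[OF hom_space_subspace] by (simp add: zero_fun_def)
  next
    fix f g :: "complex ^ 'n ^ 'n \<Rightarrow> complex"
    assume "(\<lambda>U. U $ i $ j * ctranspose U $ k $ l * f U) \<in> hom_space (Suc t)"
      "(\<lambda>U. U $ i $ j * ctranspose U $ k $ l * g U) \<in> hom_space (Suc t)"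
    from complex_fun.subspace_add[OF hom_space_subspace this]
    show "(\<lambda>U. U $ i $ j * ctranspose U $ k $ l * (f U + g U)) \<in> hom_space (Suc t)"
      by (simp add: plus_fun_def distrib_left)
  next
    fix c and f :: "complex ^ 'n ^ 'n \<Rightarrow> complex"
    assume "(\<lambda>U. U $ i $ j * ctranspose U $ k $ l * f U) \<in> hom_space (Suc t)"
    from complex_fun.subspace_scale[OF hom_space_subspace this, of c]
    show "(\<lambda>U. U $ i $ j * ctranspose U $ k $ l * fun_scale c f U) \<in> hom_space (Suc t)"
      by (simp add: fun_scale_def mult_ac)
  qed
next
  fix f :: "complex ^ 'n ^ 'n \<Rightarrow> complex" assume "f \<in> hom_monomials t"
  then obtain \<alpha> \<beta> where ab: "\<alpha> \<in> degree_exponents t" "\<beta> \<in> degree_exponents t" "f = hom_monomial \<alpha> \<beta>"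
    by (rule hom_monomialsE)
  have "(\<lambda>U. U $ i $ j * ctranspose U $ k $ l * f U) =
    hom_monomial (\<lambda>a b. \<alpha> a b + (if a = i then if b = j then 1 else 0 else 0))
      (\<lambda>a b. \<beta> a b + (if a = k then if b = l then 1 else 0 else 0))"
    unfolding hom_monomial_def matrix_monomial_increment ab(3) by (auto simp: fun_eq_iff)
  also have "\<dots> \<in> hom_monomials (Suc t)"
    using ab(1,2) by (intro hom_monomial_mem matrix_monomial_increment)
  finally show "(\<lambda>U. U $ i $ j * ctranspose U $ k $ l * f U) \<in> hom_space (Suc t)"
    unfolding hom_space_eq_span by (rule complex_fun.span_base)
qed

lemma indicator_in_hom_space_0:
  "(\<lambda>U :: complex ^ 'n ^ 'n. if U \<in> unitary_group then 1 else 0) \<in> hom_space 0"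
proof -
  have "(\<lambda>U :: complex ^ 'n ^ 'n. if U \<in> unitary_group then 1 else 0) = hom_monomial (\<lambda>_ _. 0) (\<lambda>_ _. 0)"
    by (simp add: hom_monomial_def matrix_monomial_def cong: if_cong)
  also have "\<dots> \<in> hom_monomials 0"
    by (intro hom_monomial_mem) (simp_all add: degree_exponents_def)
  finally show ?thesis unfolding hom_space_eq_span by (rule complex_fun.span_base)
qed

text \<open>On the group, 1 is the sum of \<open>U $ i $ j * ctranspose U $ j $ i\<close> over
  \<open>j\<close>, so multiplying by this sum raises both degrees without changing the function. In
  \<open>tchakaloff\<close> this membership controls the total mass.\<close>

lemma indicator_in_hom_space:
  "(\<lambda>U :: complex ^ 'n ^ 'n. if U \<in> unitary_group then 1 else 0) \<in> hom_space t"
proof (induction t)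
  case 0
  show ?case by (rule indicator_in_hom_space_0)
next
  case (Suc t)
  have "(\<lambda>U :: complex ^ 'n ^ 'n. if U \<in> unitary_group then 1 else 0) =
    (\<Sum>j\<in>UNIV. (\<lambda>U. U $ undefined $ j * ctranspose U $ j $ undefined * (if U \<in> unitary_group then 1 else 0)))"
    using unitary_row_norm by (auto simp: fun_eq_iff sum_fun_eval)
  also have "\<dots> \<in> hom_space (Suc t)"
    using Suc by (intro complex_fun.subspace_sum hom_space_subspace hom_space_mult)
  finally show ?case .
qed

text \<open>The index lists stay fixed while \<open>t\<close> grows: passing to \<open>Suc t\<close>
  multiplies by the two matrix entries at list position \<open>t\<close>.\<close>

lemma design_tensor_in_hom_space:
  fixes a b :: "'n::finite list \<times> 'n list"
  shows "(\<lambda>U. if U \<in> unitary_group then design_tensor t U a b else 0) \<in> hom_space t"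
proof -
  obtain I K J L where ab: "a = (I, K)" "b = (J, L)" by (cases a, cases b) auto
  show ?thesis
  proof (induction t)
    case 0
    show ?case using indicator_in_hom_space_0
      by (simp add: ab design_tensor_def kronecker_def tensor_power_def cong: if_cong)
  next
    case (Suc t)
    from hom_space_mult[OF this, of "I ! t" "J ! t" "K ! t" "L ! t"] show ?case
      by (simp add: ab design_tensor_def kronecker_def tensor_power_def mult_ac
        if_distrib[of "\<lambda>x. _ * x"] cong: if_cong)
  qed
qed

section \<open>Designs from Tchakaloff's theorem\<close>

theorem theorem6p2:
  fixes \<mu> :: "(complex ^ 'n ^ 'n) measure" and t :: nat
  assumes "normalized_haar \<mu>" and "t \<ge> 1"
  shows "\<exists>(X :: (complex ^ 'n ^ 'n) set) w.
           weighted_unitary_design \<mu> t X w \<and>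
           card X \<le> complex_fun.dim (hom_space t :: (complex ^ 'n ^ 'n \<Rightarrow> complex) set)"
proof -
  let ?U = "unitary_group :: (complex ^ 'n ^ 'n) set"
  let ?H = "hom_space t :: (complex ^ 'n ^ 'n \<Rightarrow> complex) set"
  interpret prob_space \<mu> using assms(1) by (simp add: normalized_haar_def)
  have sets: "sets \<mu> = sets (restrict_space borel ?U)"
    using assms(1) by (simp add: normalized_haar_def)
  then have space: "space \<mu> = ?U"
    by (simp add: sets_eq_imp_space_eq space_restrict_space)
  \<comment> \<open>A basis consisting of monomials inherits their continuity, and the conjugates of
    its elements are again monomials, hence in its span.\<close>
  obtain B :: "(complex ^ 'n ^ 'n \<Rightarrow> complex) set" where B: "B \<subseteq> hom_monomials t" "complex_fun.independent B"
    "hom_monomials t \<subseteq> complex_fun.span B"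
    using complex_fun.maximal_independent_subset[of "hom_monomials t"] by blast
  have spanB: "complex_fun.span B = ?H"
    unfolding hom_space_eq_span
    using complex_fun.span_mono[OF B(1)] complex_fun.span_minimal[OF B(3) complex_fun.subspace_span]
    by (rule subset_antisym)
  have finB: "finite B" using B(1) finite_hom_monomials finite_subset by blast
  have dimB: "complex_fun.dim ?H = card B"
    using complex_fun.dim_span_eq_card_independent[OF B(2)] spanB by simp
  have cont: "continuous_on ?U b" if "b \<in> B" for b
    using that B(1) continuous_on_hom_monomials by blast
  have int: "integrable \<mu> b" if "b \<in> B" for b
  proof -
    have "b \<in> borel_measurable \<mu>"
      using borel_measurable_continuous_on_restrict[OF cont[OF that]] measurable_cong_sets[OF sets refl] by blast
    moreover have "bounded (b ` ?U)"
      by (intro compact_imp_bounded compact_continuous_image cont that compact_unitary_group)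
    then obtain K where "\<forall>x\<in>?U. norm (b x) \<le> K" by (auto simp: bounded_iff)
    ultimately show ?thesis
      by (intro integrable_const_bound[of _ K]) (auto simp: space)
  qed
  have "\<exists>X w. finite X \<and> X \<subseteq> ?U \<and> card X \<le> card B \<and> (\<forall>x\<in>X. w x > 0) \<and> (\<Sum>x\<in>X. w x) = 1 \<and>
    (\<forall>b\<in>B. (\<Sum>x\<in>X. of_real (w x) * b x) = (\<integral>x. b x \<partial>\<mu>))"
  proof (rule tchakaloff[OF prob_space_axioms space compact_unitary_group finB int cont])
    show "(\<lambda>x. if x \<in> ?U then 1 else 0) \<in> complex_fun.span B"
      unfolding spanB by (rule indicator_in_hom_space)
    show "(\<lambda>x. cnj (f x)) \<in> complex_fun.span B" if "f \<in> B" for f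
      unfolding spanB hom_space_eq_span
      using that B(1) by (intro complex_fun.span_base cnj_hom_monomials) blast
  qed
  then obtain X w where X: "finite X" "X \<subseteq> ?U" "card X \<le> card B" "\<forall>x\<in>X. w x > 0" "(\<Sum>x\<in>X. w x) = 1"
    and exact: "\<And>b. b \<in> B \<Longrightarrow> (\<Sum>x\<in>X. of_real (w x) * b x) = (\<integral>x. b x \<partial>\<mu>)" by blast
  \<comment> \<open>Integrability is carried along since additivity of the integral depends on
    it.\<close>
  have exact_span: "integrable \<mu> f \<and> (\<Sum>x\<in>X. of_real (w x) * f x) = (\<integral>x. f x \<partial>\<mu>)"
    if "f \<in> complex_fun.span B" for f
    using that
  proof (rule complex_fun.span_induct)
    show "complex_fun.subspace {f. integrable \<mu> f \<and> (\<Sum>x\<in>X. of_real (w x) * f x) = (\<integral>x. f x \<partial>\<mu>)}"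
      by (rule complex_fun.subspaceI)
        (auto simp: fun_scale_def plus_fun_def zero_fun_def distrib_left sum.distrib mult.left_commute
          simp flip: sum_distrib_left)
  qed (use exact int in auto)
  have "(\<Sum>U\<in>X. of_real (w U) * design_tensor t U a b) = (\<integral>U. design_tensor t U a b \<partial>\<mu>)" for a b
  proof -
    \<comment> \<open>The tensor entry is cut off outside the group to become an element of
      \<open>hom_space t\<close>; sum and integral do not change, as \<open>X\<close> and
      \<open>space \<mu>\<close> lie in the group.\<close>
    let ?f = "\<lambda>U. if U \<in> ?U then design_tensor t U a b else 0"
    have "(\<Sum>U\<in>X. of_real (w U) * design_tensor t U a b) = (\<Sum>U\<in>X. of_real (w U) * ?f U)"
      using X(2) by (intro sum.cong) auto
    also have "\<dots> = (\<integral>U. ?f U \<partial>\<mu>)"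
      using exact_span[of ?f] design_tensor_in_hom_space spanB by blast
    also have "\<dots> = (\<integral>U. design_tensor t U a b \<partial>\<mu>)"
      by (intro Bochner_Integration.integral_cong) (auto simp: space)
    finally show ?thesis .
  qed
  with X dimB show ?thesis
    unfolding weighted_unitary_design_def by (intro exI[of _ X] exI[of _ w]) simp
qed

end
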